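(* Let $q\ge0$ and $k\ge1$ be integers. Given any $2^{q+k-1}$ masses $\mu_1,\ldots,\mu_{2^{q+k-1}}$ on $\mathbb{R}^{2^{q+k-1}}$, there exist $k$ hyperplanes $H_1,\ldots,H_k$ such that, for all $1\le i\le k$, the hyperplanes $H_i,\ldots,H_k$ equipartition each of $\mu_1,\ldots,\mu_{2^{q+i-1}}$.
   Context: A mass (mass distribution) on $\mathbb{R}^d$ is a positive, finite Borel measure $\mu$ such that every hyperplane has $\mu$-measure zero. Given hyperplanes $H_1,\ldots,H_\ell$ in $\mathbb{R}^d$ with closed half-spaces $H_i^0,H_i^1$ bounded by $H_i$, they equipartition $\mu$ if $\mu(H_1^{g_1}\cap\cdots\cap H_\ell^{g_\ell})=\frac{1}{2^\ell}\mu(\mathbb{R}^d)$ for all $(g_1,\ldots,g_\ell)\in\{0,1\}^\ell$. *)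

theory Defs
  imports "HOL-Analysis.Analysis"
begin

definition hyperplane :: "'a::euclidean_space set \<Rightarrow> bool" where
  "hyperplane H \<longleftrightarrow> (\<exists>a b. a \<noteq> 0 \<and> H = {x. a \<bullet> x = b})"

text \<open>The two half-spaces bounded by a hyperplane are unordered; \<open>closed_half_spaces H S T\<close>
  holds for either order of the pair \<open>S\<close>, \<open>T\<close>, since \<open>(a, b)\<close> may be replaced by \<open>(-a, -b)\<close>.\<close>

definition closed_half_spaces :: "'a::euclidean_space set \<Rightarrow> 'a set \<Rightarrow> 'a set \<Rightarrow> bool" where
  "closed_half_spaces H S T \<longleftrightarrow>
     (\<exists>a b. a \<noteq> 0 \<and> H = {x. a \<bullet> x = b} \<and> S = {x. a \<bullet> x \<ge> b} \<and> T = {x. a \<bullet> x \<le> b})"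

text \<open>Positivity of the measure means nonnegativity, which is built into the type; the zero
  measure is therefore a mass.\<close>

definition mass :: "'a::euclidean_space measure \<Rightarrow> bool" where
  "mass \<mu> \<longleftrightarrow> sets \<mu> = sets borel \<and> finite_measure \<mu> \<and> (\<forall>H. hyperplane H \<longrightarrow> measure \<mu> H = 0)"

text \<open>The condition ranges over all labels \<open>g\<close>, so it does not depend on which of the two
  half-spaces of each \<open>H i\<close> is called \<open>P i 0\<close>; the labelling \<open>P\<close> may thus be quantified
  existentially.\<close>

definition equipartition :: "nat set \<Rightarrow> (nat \<Rightarrow> 'a::euclidean_space set) \<Rightarrow> 'a measure \<Rightarrow> bool" where
  "equipartition I H \<mu> \<longleftrightarrow>
     (\<exists>P :: nat \<Rightarrow> nat \<Rightarrow> 'a set.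
        (\<forall>i\<in>I. closed_half_spaces (H i) (P i 0) (P i 1)) \<and>
        (\<forall>g \<in> I \<rightarrow> {0, 1}. measure \<mu> (\<Inter>i\<in>I. P i (g i)) = 1 / 2 ^ card I * measure \<mu> UNIV))"

end

theory Submission
  imports Defs "HOL-Homology.Homology"
begin

text \<open>
  The hyperplanes are chosen one at a time in the order \<open>H\<^sub>k, H\<^sub>k\<^sub>-\<^sub>1, \<dots>, H\<^sub>1\<close>, each by the ham sandwich
  theorem. Once \<open>H\<^sub>i\<^sub>+\<^sub>1, \<dots>, H\<^sub>k\<close> are known, they cut each of the first \<open>2^(q+i-1)\<close> masses into
  \<open>2^(k-i)\<close> pieces of equal measure. These are \<open>2^(q+i-1) \<sqdot> 2^(k-i) = 2^(q+k-1)\<close> pieces, exactly the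
  dimension of the space, and each piece is again a mass. Hence a single hyperplane \<open>H\<^sub>i\<close> bisects all of
  them, which is the equipartition property for \<open>H\<^sub>i, \<dots>, H\<^sub>k\<close> (lemma \<open>bisect_successively\<close>).

  The ham sandwich theorem follows from the Borsuk-Ulam theorem in the usual way: the affine functions
  \<open>x \<mapsto> a \<bullet> x - b\<close> on a \<open>d\<close>-dimensional space, up to positive scaling, form a \<open>d\<close>-sphere, and the
  difference of the measures of the two sides of the zero set is an odd continuous function on it.

  The Borsuk-Ulam theorem is proved by combining singular homology with Ky Fan's parity count. Vanishing
  of the lower homology of the \<open>n\<close>-sphere gives singular chains \<open>c\<^sub>0, \<dots>, c\<^sub>n\<close>, where \<open>c\<^sub>0\<close> is a point,
  with \<open>\<partial> c\<^sub>i\<^sub>+\<^sub>1 = c\<^sub>i \<plusminus> \<nu> c\<^sub>i\<close> for the antipodal map \<open>\<nu>\<close>; they play the role of hemispheres of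
  increasing dimension. Barycentric subdivision preserves these equations and makes all simplices small.
  If \<open>f\<close> is an odd map to \<open>\<real>\<^sup>n\<close> without zeros, label every point \<open>x\<close> by an index \<open>t x < n\<close> of a
  relatively large coordinate of \<open>f x\<close>, together with the sign of that coordinate. Small simplices have no
  two vertices with the same index and opposite signs. Call a simplex alternating if its indices are
  distinct and the signs alternate when the vertices are sorted by index. Modulo 2, the number of facets of
  a simplex that alternate starting with \<open>+\<close> tells whether the simplex itself alternates (lemma
  \<open>even_fan_simplex_facets\<close>). Counting over \<open>\<partial> c\<^sub>i\<^sub>+\<^sub>1\<close> shows that the parity of the number of alternating
  simplices is the same in \<open>c\<^sub>i\<^sub>+\<^sub>1\<close> as in \<open>c\<^sub>i\<close>. It is odd in \<open>c\<^sub>0\<close>, but an alternating \<open>n\<close>-simplex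
  would need \<open>n + 1\<close> distinct indices (lemmas \<open>ky_fan_nsphere\<close> and \<open>borsuk_ulam\<close>).
\<close>

section \<open>Alternating sign patterns\<close>

primrec alternating :: "bool \<Rightarrow> bool list \<Rightarrow> bool" where
  "alternating b [] = True"
| "alternating b (x # xs) = (x = b \<and> alternating (\<not> b) xs)"

lemma alternating_map_Not: "alternating b (map (\<lambda>x. \<not> s x) xs) = alternating (\<not> b) (map s xs)"
  by (induction xs arbitrary: b) auto

text \<open>An alternating sequence leaves a sequence alternating from \<open>b\<close> for exactly one deletion: of its last entry
  if it starts with \<open>b\<close>, and of its first entry otherwise. Any other sequence has two equal
  neighbours; only deleting one of these can help, and both deletions have the same result. The induction on
  the list, which separates the deletion of the head, treats all these cases at once.\<close>

lemma even_alternating_remove1: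
  assumes "distinct xs" "xs \<noteq> []"
  shows "even ((\<Sum>x\<in>set xs. of_bool (alternating b (map s (remove1 x xs))))
     + of_bool (alternating b (map s xs)) + of_bool (alternating (\<not> b) (map s xs)) :: int)"
  using assms
proof (induction xs arbitrary: b)
  case (Cons x ys)
  have x: "x \<notin> set ys" and "distinct ys"
    using Cons.prems by auto
  have "(\<Sum>y\<in>set (x # ys). of_bool (alternating b (map s (remove1 y (x # ys)))) :: int)
      = of_bool (alternating b (map s ys)) +
        (\<Sum>y\<in>set ys. of_bool (s x = b \<and> alternating (\<not> b) (map s (remove1 y ys))))"
  proof -
    have "alternating b (map s (remove1 y (x # ys))) \<longleftrightarrow> s x = b \<and> alternating (\<not> b) (map s (remove1 y ys))"
      if "y \<in> set ys" for y
      using that x by auto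
    then show ?thesis
      using x by (simp del: sum_of_bool_eq)
  qed
  also have "\<dots> = of_bool (alternating b (map s ys)) + of_bool (s x = b) *
        (\<Sum>y\<in>set ys. of_bool (alternating (\<not> b) (map s (remove1 y ys))))"
    by (simp add: sum_distrib_left of_bool_conj)
  finally have eq: "(\<Sum>y\<in>set (x # ys). of_bool (alternating b (map s (remove1 y (x # ys)))) :: int) = \<dots>" .
  show ?case
  proof (cases "ys = []")
    case True
    then show ?thesis by (cases "s x") auto
  next
    case False
    with Cons.IH[of "\<not> b"] \<open>distinct ys\<close> show ?thesis
      unfolding eq by (cases "s x = b"; cases "s x") auto
  qed
qed simp

text \<open>The vertices of a simplex are indexed by \<open>K\<close>; vertex \<open>i\<close> has label \<open>t i\<close>, and signs are attached to
  labels by \<open>s\<close>. The sign can be a function of the label, rather than of the vertex, because only simplices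
  without complementary labels matter.\<close>

definition fan :: "bool \<Rightarrow> 'i set \<Rightarrow> ('i \<Rightarrow> nat) \<Rightarrow> (nat \<Rightarrow> bool) \<Rightarrow> bool" where
  "fan b K t s \<longleftrightarrow> inj_on t K \<and> alternating b (map s (sorted_list_of_set (t ` K)))"

lemma fan_cong:
  assumes "finite K" "\<And>i. i \<in> K \<Longrightarrow> t i = t' i" "\<And>i. i \<in> K \<Longrightarrow> s (t' i) = s' (t' i)"
  shows "fan b K t s = fan b K t' s'"
proof -
  have "inj_on t K = inj_on t' K"
    using assms(2) by (rule inj_on_cong)
  moreover have "t ` K = t' ` K"
    using assms(2) by (rule image_cong[OF refl])
  moreover have "map s (sorted_list_of_set (t' ` K)) = map s' (sorted_list_of_set (t' ` K))"
    using assms by auto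
  ultimately show ?thesis by (simp only: fan_def)
qed

text \<open>Ky Fan's local parity identity. If the labels are distinct, deleting a vertex deletes an entry of the
  sorted sign sequence. If two vertices share a label, only the two facets opposite to them can be
  alternating, and these carry the same labels.\<close>

lemma even_fan_facets:
  assumes "finite K" "K \<noteq> {}"
  shows "even ((\<Sum>k\<in>K. of_bool (fan b (K - {k}) t s)) + of_bool (fan b K t s) + of_bool (fan (\<not> b) K t s) :: int)"
proof (cases "inj_on t K")
  case True
  let ?xs = "sorted_list_of_set (t ` K)"
  have fan: "fan b (K - {k}) t s = alternating b (map s (remove1 (t k) ?xs))" if "k \<in> K" for k
  proof -
    have "t ` (K - {k}) = t ` K - {t k}"
      using True that by (auto simp: inj_on_def)
    then show ?thesis
      using True assms by (simp add: fan_def inj_on_diff sorted_list_of_set.sorted_key_list_of_set_remove)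
  qed
  have "(\<Sum>k\<in>K. of_bool (fan b (K - {k}) t s) :: int) = (\<Sum>x\<in>set ?xs. of_bool (alternating b (map s (remove1 x ?xs))))"
    using assms(1) by (simp add: sum.reindex[OF True] fan)
  then show ?thesis
    using even_alternating_remove1[of ?xs b s] assms True by (simp add: fan_def)
next
  case False
  then obtain i j where ij: "i \<in> K" "j \<in> K" "t i = t j" "i \<noteq> j"
    by (auto simp: inj_on_def)
  have "\<not> fan b (K - {k}) t s" if "k \<noteq> i" "k \<noteq> j" for k
    using ij that by (auto simp: fan_def inj_on_def)
  then have "(\<Sum>k\<in>K. of_bool (fan b (K - {k}) t s) :: int) = (\<Sum>k\<in>{i, j}. of_bool (fan b (K - {k}) t s))"
    using ij assms by (intro sum.mono_neutral_right) auto
  moreover have "fan b (K - {i}) t s = fan b (K - {j}) t s"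
  proof -
    have im: "t ` (K - {i}) = t ` (K - {j})"
    proof -
      have "t ` (K - {i}) = t ` K" "t ` (K - {j}) = t ` K"
        using ij by (auto simp: image_iff; metis DiffI singletonD)+
      then show ?thesis by simp
    qed
    have "inj_on t (K - {i}) = inj_on t (K - {j})"
      using assms by (simp add: inj_on_iff_eq_card im ij)
    with im show ?thesis by (simp add: fan_def)
  qed
  ultimately have "(\<Sum>k\<in>K. of_bool (fan b (K - {k}) t s) :: int) = 2 * of_bool (fan b (K - {i}) t s)"
    using ij(4) by (simp del: sum_of_bool_eq)
  with False show ?thesis
    by (simp add: fan_def del: sum_of_bool_eq)
qed

text \<open>Since \<open>s\<close> is here a sign of points, it is transferred to labels: a label is positive if some vertex with
  this label is.\<close>

definition fan_simplex ::
    "('a \<Rightarrow> nat) \<Rightarrow> ('a \<Rightarrow> bool) \<Rightarrow> bool \<Rightarrow> nat \<Rightarrow> ((nat \<Rightarrow> real) \<Rightarrow> 'a) \<Rightarrow> bool" where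
  "fan_simplex t s b p \<sigma> \<longleftrightarrow>
     fan b {..p} (\<lambda>i. t (simplicial_vertex i \<sigma>))
       (\<lambda>j. \<exists>i\<le>p. t (simplicial_vertex i \<sigma>) = j \<and> s (simplicial_vertex i \<sigma>))"

definition no_complementary_edge :: "('a \<Rightarrow> nat) \<Rightarrow> ('a \<Rightarrow> bool) \<Rightarrow> nat \<Rightarrow> ((nat \<Rightarrow> real) \<Rightarrow> 'a) \<Rightarrow> bool" where
  "no_complementary_edge t s p \<sigma> \<longleftrightarrow>
     (\<forall>i\<le>p. \<forall>j\<le>p. t (simplicial_vertex i \<sigma>) = t (simplicial_vertex j \<sigma>) \<longrightarrow>
        s (simplicial_vertex i \<sigma>) = s (simplicial_vertex j \<sigma>))"

text \<open>The coface map: the vertices of the face opposite to vertex \<open>k\<close>, in order, have indices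
  \<open>skip_index k 0\<close>, \<open>skip_index k 1\<close>, and so on.\<close>

definition skip_index :: "nat \<Rightarrow> nat \<Rightarrow> nat" where
  "skip_index k i = (if i < k then i else Suc i)"

lemma bij_betw_skip_index: "k \<le> Suc p \<Longrightarrow> bij_betw (skip_index k) {..p} ({..Suc p} - {k})"
  by (rule bij_betw_byWitness[where f' = "\<lambda>i. if i < k then i else i - 1"])
     (auto simp: skip_index_def)

lemma simplicial_vertex_singular_face:
  assumes "i \<le> p"
  shows "simplicial_vertex i (singular_face (Suc p) k \<sigma>) = simplicial_vertex (skip_index k i) \<sigma>"
proof -
  have "simplical_face k (\<lambda>j. if j = i then 1 else 0::real) = (\<lambda>j. if j = skip_index k i then 1 else 0)"
    by (auto simp: simplical_face_def skip_index_def fun_eq_iff)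
  then show ?thesis
    using assms by (simp add: simplicial_vertex_def singular_face_def)
qed

lemma fan_bij_betw:
  assumes "bij_betw h A B"
  shows "fan b A (\<lambda>i. t (h i)) s = fan b B t s"
proof -
  have "B = h ` A" "inj_on h A" using assms by (auto simp: bij_betw_def)
  then show ?thesis
    by (auto simp: fan_def image_image inj_on_def)
qed

lemma even_fan_simplex_facets:
  assumes "no_complementary_edge t s (Suc p) \<sigma>"
  shows "even ((\<Sum>k\<le>Suc p. of_bool (fan_simplex t s b p (singular_face (Suc p) k \<sigma>)))
    + of_bool (fan_simplex t s b (Suc p) \<sigma>) + of_bool (fan_simplex t s (\<not> b) (Suc p) \<sigma>) :: int)"
proof -
  define v where "v = (\<lambda>i. simplicial_vertex i \<sigma>)"
  define u where "u = (\<lambda>j. \<exists>i\<le>Suc p. t (v i) = j \<and> s (v i))"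
  have u: "u (t (v i)) = s (v i)" if "i \<le> Suc p" for i
    using assms that unfolding u_def v_def no_complementary_edge_def by blast
  have face: "fan_simplex t s b p (singular_face (Suc p) k \<sigma>) = fan b ({..Suc p} - {k}) (\<lambda>i. t (v i)) u"
    if k: "k \<le> Suc p" for k
  proof -
    let ?w = "\<lambda>i. simplicial_vertex i (singular_face (Suc p) k \<sigma>)"
    have w: "?w i = v (skip_index k i)" if "i \<le> p" for i
      using that by (simp add: simplicial_vertex_singular_face v_def)
    have sk: "skip_index k i \<le> Suc p" if "i \<le> p" for i
      using that by (simp add: skip_index_def)
    have "fan_simplex t s b p (singular_face (Suc p) k \<sigma>) = fan b {..p} (\<lambda>i. t (v (skip_index k i))) u"
      unfolding fan_simplex_def
    proof (intro fan_cong)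
      fix i assume "i \<in> {..p}"
      then show "(\<exists>i'\<le>p. t (?w i') = t (v (skip_index k i)) \<and> s (?w i')) = u (t (v (skip_index k i)))"
        using u sk by (metis atMost_iff w)
    qed (simp_all add: w)
    also have "\<dots> = fan b ({..Suc p} - {k}) (\<lambda>i. t (v i)) u"
      by (rule fan_bij_betw[OF bij_betw_skip_index[OF k]])
    finally show ?thesis .
  qed
  have "fan_simplex t s b' (Suc p) \<sigma> = fan b' {..Suc p} (\<lambda>i. t (v i)) u" for b'
    by (simp add: fan_simplex_def u_def v_def)
  with even_fan_facets[of "{..Suc p}" b "\<lambda>i. t (v i)" u] face show ?thesis
    by simp
qed

text \<open>The additive extension of \<open>fan_simplex\<close> from simplices to integral chains. It is realised as a chain over
  the one-point type followed by reading off the only coefficient, so that it inherits additivity from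
  \<open>frag_extend\<close>.\<close>

definition fan_count ::
    "('a \<Rightarrow> nat) \<Rightarrow> ('a \<Rightarrow> bool) \<Rightarrow> bool \<Rightarrow> nat \<Rightarrow> 'a chain \<Rightarrow> int" where
  "fan_count t s b p c =
     Poly_Mapping.lookup (frag_extend (\<lambda>\<sigma>. frag_cmul (of_bool (fan_simplex t s b p \<sigma>)) (frag_of ())) c) ()"

lemma fan_count_of [simp]: "fan_count t s b p (frag_of \<sigma>) = of_bool (fan_simplex t s b p \<sigma>)"
  by (simp add: fan_count_def)

lemma fan_count_0 [simp]: "fan_count t s b p 0 = 0"
  by (simp add: fan_count_def)

lemma fan_count_diff: "fan_count t s b p (c - d) = fan_count t s b p c - fan_count t s b p d"
  by (simp add: fan_count_def frag_extend_diff lookup_minus)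

lemma fan_count_add: "fan_count t s b p (c + d) = fan_count t s b p c + fan_count t s b p d"
  by (simp add: fan_count_def frag_extend_add lookup_add)

lemma fan_count_cmul: "fan_count t s b p (frag_cmul n c) = n * fan_count t s b p c"
  by (simp add: fan_count_def frag_extend_cmul)

lemma fan_count_sum: "finite I \<Longrightarrow> fan_count t s b p (sum c I) = (\<Sum>i\<in>I. fan_count t s b p (c i))"
  by (induction I rule: finite_induct) (auto simp: fan_count_add)

text \<open>The signs in the singular boundary are irrelevant modulo 2, so the identity for one simplex extends
  additively to chains.\<close>

lemma even_fan_count_boundary:
  assumes "Poly_Mapping.keys c \<subseteq> Collect (no_complementary_edge t s (Suc p))"
  shows "even (fan_count t s b p (chain_boundary (Suc p) c)
    + fan_count t s b (Suc p) c + fan_count t s (\<not> b) (Suc p) c)"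
  using assms
proof (induction c rule: frag_induction)
  case (one \<sigma>)
  have "even (\<Sum>k\<le>Suc p. (- 1) ^ k * of_bool (P k) - of_bool (P k) :: int)" for P
    by (intro dvd_sum) auto
  then have "even ((\<Sum>k\<le>Suc p. (- 1) ^ k * of_bool (P k) :: int) - (\<Sum>k\<le>Suc p. of_bool (P k)))" for P
    by (simp only: sum_subtractf)
  moreover have "fan_count t s b p (chain_boundary (Suc p) (frag_of \<sigma>))
    = (\<Sum>k\<le>Suc p. (- 1) ^ k * of_bool (fan_simplex t s b p (singular_face (Suc p) k \<sigma>)))"
    by (simp only: chain_boundary_of nat.distinct if_False fan_count_sum finite_atMost fan_count_cmul fan_count_of)
  ultimately show ?case
    using even_fan_simplex_facets[of t s p \<sigma> b] one by (simp del: sum.atMost_Suc)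
qed (auto simp: chain_boundary_diff fan_count_diff)

text \<open>An odd labelling reverses all signs under the antipodal map and keeps the order of the vertices by label.\<close>

lemma fan_count_antipode:
  assumes "Poly_Mapping.keys c \<subseteq> {\<sigma>. no_complementary_edge t s p \<sigma> \<and> \<sigma> \<in> standard_simplex p \<rightarrow> S}"
    and "\<And>x. x \<in> S \<Longrightarrow> t (\<nu> x) = t x" "\<And>x. x \<in> S \<Longrightarrow> s (\<nu> x) \<longleftrightarrow> \<not> s x"
  shows "fan_count t s b p (chain_map p \<nu> c) = fan_count t s (\<not> b) p c"
  using assms(1)
proof (induction c rule: frag_induction)
  case (one \<sigma>)
  let ?v = "\<lambda>i. simplicial_vertex i \<sigma>"
  let ?w = "\<lambda>i. simplicial_vertex i (simplex_map p \<nu> \<sigma>)"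
  have w: "?w i = \<nu> (?v i)" "?v i \<in> S" if "i \<le> p" for i
  proof -
    have "(\<lambda>j. if j = i then 1 else 0) \<in> standard_simplex p"
      using that by simp
    then show "?w i = \<nu> (?v i)" "?v i \<in> S"
      using one by (auto simp: simplicial_vertex_def simplex_map_def)
  qed
  have t: "t (?w i) = t (?v i)" "s (?w i) \<longleftrightarrow> \<not> s (?v i)" if "i \<le> p" for i
    using that assms w by simp_all
  have "fan_simplex t s b p (simplex_map p \<nu> \<sigma>)
      = fan b {..p} (\<lambda>i. t (?v i)) (\<lambda>j. \<not> (\<exists>i\<le>p. t (?v i) = j \<and> s (?v i)))"
    unfolding fan_simplex_def
  proof (intro fan_cong)
    fix i assume "i \<in> {..p}"
    then show "(\<exists>i'\<le>p. t (?w i') = t (?v i) \<and> s (?w i')) = (\<not> (\<exists>i'\<le>p. t (?v i') = t (?v i) \<and> s (?v i')))"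
      using one t unfolding no_complementary_edge_def by (smt (verit) atMost_iff mem_Collect_eq)
  qed (simp_all add: t)
  also have "\<dots> = fan_simplex t s (\<not> b) p \<sigma>"
    unfolding fan_def fan_simplex_def by (simp add: alternating_map_Not del: ex_simps not_ex)
  finally show ?case by simp
qed (auto simp: fan_count_diff chain_map_diff)

text \<open>Pigeonhole: a simplex with \<open>p + 1\<close> vertices cannot have distinct labels below \<open>p\<close>.\<close>

lemma fan_count_eq_0:
  assumes "Poly_Mapping.keys c \<subseteq> {\<sigma>. \<sigma> \<in> standard_simplex p \<rightarrow> S}" "\<And>x. x \<in> S \<Longrightarrow> t x < p"
  shows "fan_count t s b p c = 0"
  using assms(1)
proof (induction c rule: frag_induction)
  case (one \<sigma>)
  have "t (simplicial_vertex i \<sigma>) < p" if "i \<le> p" for i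
  proof -
    have "(\<lambda>j. if j = i then 1 else 0) \<in> standard_simplex p"
      using that by simp
    then show ?thesis
      using one assms(2) by (simp add: simplicial_vertex_def Pi_iff)
  qed
  then have "(\<lambda>i. t (simplicial_vertex i \<sigma>)) ` {..p} \<subseteq> {..<p}" by auto
  then have "\<not> inj_on (\<lambda>i. t (simplicial_vertex i \<sigma>)) {..p}"
    using card_inj_on_le[of "\<lambda>i. t (simplicial_vertex i \<sigma>)" "{..p}" "{..<p}"] by auto
  then show ?case by (simp add: fan_simplex_def fan_def)
qed (auto simp: fan_count_diff)

section \<open>The Borsuk-Ulam theorem\<close>

definition antipode :: "(nat \<Rightarrow> real) \<Rightarrow> nat \<Rightarrow> real" where
  "antipode x = (\<lambda>i. - x i)"

lemma antipode_antipode: "antipode \<circ> antipode = id"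
  by (auto simp: antipode_def)

lemma continuous_map_antipode: "continuous_map (nsphere n) (nsphere n) antipode"
proof -
  have "continuous_map (nsphere n) euclideanreal (\<lambda>x. - x k)" for k
    by (intro continuous_map_minus continuous_map_nsphere_projection)
  moreover have "antipode \<in> topspace (nsphere n) \<rightarrow> topspace (nsphere n)"
    by (auto simp: nsphere antipode_def)
  ultimately show ?thesis
    by (subst (2) nsphere) (auto simp: nsphere antipode_def continuous_map_in_subtopology continuous_map_componentwise_UNIV Pi_iff)
qed

lemma chain_map_antipode_antipode:
  assumes "singular_chain p (nsphere n) c"
  shows "chain_map p antipode (chain_map p antipode c) = c"
  using chain_map_id_gen[OF assms, of id] chain_map_compose[of p antipode antipode]
  by (metis antipode_antipode comp_apply id_apply)

text \<open>The reduced homology of the \<open>n\<close>-sphere vanishes in all degrees other than \<open>n\<close>. In degree \<open>0\<close> a chain is a reduced cycle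
  if its coefficients sum to zero, which is expressed here by its image in a one-point space.\<close>

lemma nsphere_cycle_is_boundary:
  assumes "singular_chain p (nsphere n) c" "chain_boundary p c = 0" "p \<noteq> n"
    and "p = 0 \<Longrightarrow> chain_map 0 (\<lambda>x. ()) c = 0"
  shows "\<exists>d. singular_chain (Suc p) (nsphere n) d \<and> chain_boundary (Suc p) d = c"
proof -
  let ?X = "nsphere n"
  have triv: "trivial_group (reduced_homology_group (int p) ?X)"
    using assms(3) by (simp add: trivial_reduced_homology_group_nsphere)
  have cyc: "singular_relcycle p ?X {} c"
    using assms by (simp add: singular_cycle)
  have in_hom: "homologous_rel_set p ?X {} c \<in> carrier (homology_group (int p) ?X)"
    using cyc by (auto simp: carrier_relative_homology_group)
  have "homologous_rel_set p ?X {} c \<in> carrier (reduced_homology_group (int p) ?X)"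
  proof (cases "p = 0")
    case True
    have cm: "continuous_map ?X (discrete_topology {()}) (\<lambda>x. ())"
      by simp
    have "hom_induced (int p) ?X {} (discrete_topology {()}) {} (\<lambda>x. ()) (homologous_rel_set p ?X {} c)
       = homologous_rel_set p (discrete_topology {()}) {} (chain_map p (\<lambda>x. ()) c)"
      by (rule hom_induced_chain_map[OF cm _ cyc]) simp
    also have "\<dots> = \<one>\<^bsub>homology_group (int p) (discrete_topology {()})\<^esub>"
      unfolding one_relative_homology_group homologous_rel_set_eq_relboundary
      using assms(4) True by simp
    finally show ?thesis
      using in_hom by (simp add: carrier_reduced_homology_group kernel_def)
  next
    case False
    then show ?thesis using in_hom by (simp add: un_reduced_homology_group)
  qed
  then have "homologous_rel_set p ?X {} c = \<one>\<^bsub>homology_group (int p) ?X\<^esub>"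
    using triv by (simp add: trivial_group_def one_reduced_homology_group)
  then have "singular_relboundary p ?X {} c"
    by (simp add: homologous_rel_set_eq_relboundary)
  then show ?thesis by (simp add: singular_boundary)
qed

text \<open>The model is the sphere with its equators: \<open>c i\<close> stands for a closed hemisphere of the \<open>i\<close>-dimensional
  equator, whose boundary is the equator one dimension lower, that is, the union of a hemisphere and its
  antipodal image. The antipodal map of the \<open>i\<close>-sphere has degree \<open>(-1)^(i+1)\<close>, whence the sign.\<close>

definition antipodal_tower :: "nat \<Rightarrow> nat \<Rightarrow> (nat \<Rightarrow> (nat \<Rightarrow> real) chain) \<Rightarrow> bool" where
  "antipodal_tower n m c \<longleftrightarrow> c 0 \<in> range frag_of
     \<and> (\<forall>i\<le>m. singular_chain i (nsphere n) (c i))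
     \<and> (\<forall>i<m. chain_boundary (Suc i) (c (Suc i)) = c i + frag_cmul ((-1) ^ Suc i) (chain_map i antipode (c i)))"

text \<open>With \<open>\<nu>\<close> the antipodal map, the chain \<open>z = c\<^sub>m + (-1)^(m+1) \<nu> c\<^sub>m\<close> is a cycle because \<open>\<nu>\<close> is an involution
  and the signs alternate with \<open>m\<close>; hence it bounds for \<open>m < n\<close>, and a chain with boundary \<open>z\<close> continues the
  tower.\<close>

lemma antipodal_tower_exists: "m \<le> n \<Longrightarrow> \<exists>c. antipodal_tower n m c"
proof (induction m)
  case 0
  define \<sigma> where "\<sigma> = restrict (\<lambda>_ (j::nat). if j = 0 then 1 else 0 :: real) (standard_simplex 0)"
  have "singular_simplex 0 (nsphere n) \<sigma>"
    using in_topspace_nsphere by (auto simp: singular_simplex_def \<sigma>_def)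
  then have "antipodal_tower n 0 (\<lambda>_. frag_of \<sigma>)"
    by (simp add: antipodal_tower_def singular_chain_of)
  then show ?case by blast
next
  case (Suc m)
  then obtain c where c: "antipodal_tower n m c" by auto
  let ?\<nu> = "chain_map m antipode"
  let ?z = "c m + frag_cmul ((-1) ^ Suc m) (?\<nu> (c m))"
  have cm: "singular_chain m (nsphere n) (c m)"
    using c by (simp add: antipodal_tower_def)
  have \<nu>cm: "singular_chain m (nsphere n) (?\<nu> (c m))"
    using singular_chain_chain_map[OF cm continuous_map_antipode] .
  have "\<exists>d. singular_chain (Suc m) (nsphere n) d \<and> chain_boundary (Suc m) d = ?z"
  proof (rule nsphere_cycle_is_boundary)
    show "singular_chain m (nsphere n) ?z"
      using cm \<nu>cm by (simp add: singular_chain_add singular_chain_cmul del: power_Suc)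
    show "chain_boundary m ?z = 0"
    proof (cases m)
      case 0
      then show ?thesis by (simp add: chain_boundary_def)
    next
      case (Suc i)
      let ?\<mu> = "chain_map i antipode"
      have ci: "singular_chain i (nsphere n) (c i)"
        using c Suc by (simp add: antipodal_tower_def)
      have bd: "chain_boundary m (c m) = c i + frag_cmul ((-1) ^ m) (?\<mu> (c i))"
        using c Suc by (simp add: antipodal_tower_def)
      have "chain_boundary m (?\<nu> (c m)) = ?\<mu> (chain_boundary m (c m))"
        using chain_boundary_chain_map[OF cm] Suc by simp
      also have "\<dots> = ?\<mu> (c i) + frag_cmul ((-1) ^ m) (c i)"
        by (simp add: bd chain_map_add chain_map_antipode_antipode[OF ci])
      finally show ?thesis
        by (simp add: chain_boundary_add chain_boundary_cmul bd frag_cmul_distrib2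
            flip: power_add mult_2 frag_cmul_distrib)
    qed
    show "m \<noteq> n" using Suc by simp
    show "chain_map 0 (\<lambda>x. ()) ?z = 0" if "m = 0"
    proof -
      obtain \<sigma> where "c 0 = frag_of \<sigma>" using c by (auto simp: antipodal_tower_def)
      moreover have "simplex_map 0 (\<lambda>x. ()) (simplex_map 0 antipode \<sigma>) = simplex_map 0 (\<lambda>x. ()) \<sigma>"
        by (auto simp: simplex_map_def)
      ultimately show ?thesis
        using that by (simp add: chain_map_diff chain_map_add chain_map_minus)
    qed
  qed
  then obtain d where d: "singular_chain (Suc m) (nsphere n) d" "chain_boundary (Suc m) d = ?z" by blast
  have "antipodal_tower n (Suc m) (c(Suc m := d))"
    using c d unfolding antipodal_tower_def by (auto simp: le_Suc_eq less_Suc_eq simp del: power_Suc)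
  then show ?case by blast
qed

lemma singular_chain_subdivision_power:
  "singular_chain p X c \<Longrightarrow> singular_chain p X ((singular_subdivision p ^^ N) c)"
  by (induction N) (auto intro: singular_chain_singular_subdivision)

lemma singular_subdivision_power_chain_map:
  assumes "singular_chain p X c"
  shows "(singular_subdivision p ^^ N) (chain_map p g c) = chain_map p g ((singular_subdivision p ^^ N) c)"
  by (induction N)
     (auto simp: naturality_singular_subdivision[OF singular_chain_subdivision_power[OF assms]])

lemma chain_boundary_subdivision_power:
  assumes "singular_chain p X c"
  shows "chain_boundary p ((singular_subdivision p ^^ N) c)
    = (singular_subdivision (p - 1) ^^ N) (chain_boundary p c)"
  by (induction N)
     (auto simp: chain_boundary_singular_subdivision[OF singular_chain_subdivision_power[OF assms]])

lemma singular_subdivision_power_add: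
  "(singular_subdivision p ^^ N) (a + b) = (singular_subdivision p ^^ N) a + (singular_subdivision p ^^ N) b"
  by (induction N) (auto simp: singular_subdivision_add)

lemma singular_subdivision_power_cmul:
  "(singular_subdivision p ^^ N) (frag_cmul k a) = frag_cmul k ((singular_subdivision p ^^ N) a)"
  by (induction N) (auto simp: singular_subdivision_def frag_extend_cmul)

lemma antipodal_tower_subdivision:
  assumes "antipodal_tower n m c"
  shows "antipodal_tower n m (\<lambda>i. (singular_subdivision i ^^ N) (c i))"
proof -
  have c: "singular_chain i (nsphere n) (c i)" if "i \<le> m" for i
    using assms that by (simp add: antipodal_tower_def)
  obtain \<sigma> where \<sigma>: "c 0 = frag_of \<sigma>" using assms by (auto simp: antipodal_tower_def)
  have "(singular_subdivision 0 ^^ N) (c 0) = c 0"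
    by (induction N) (use c[of 0] singular_subdivision_zero in auto)
  moreover have "chain_boundary (Suc i) ((singular_subdivision (Suc i) ^^ N) (c (Suc i)))
      = (singular_subdivision i ^^ N) (c i)
        + frag_cmul ((-1) ^ Suc i) (chain_map i antipode ((singular_subdivision i ^^ N) (c i)))"
    if "i < m" for i
  proof -
    have "chain_boundary (Suc i) (c (Suc i)) = c i + frag_cmul ((-1) ^ Suc i) (chain_map i antipode (c i))"
      using assms that unfolding antipodal_tower_def by blast
    then show ?thesis
      using chain_boundary_subdivision_power[OF c[of "Suc i"], of N] that
      by (simp add: singular_subdivision_power_add singular_subdivision_power_cmul
          singular_subdivision_power_chain_map[OF c] del: power_Suc)
  qed
  ultimately show ?thesis
    using \<sigma> singular_chain_subdivision_power[OF c] unfolding antipodal_tower_def by (simp del: power_Suc)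
qed

text \<open>Subdivision commutes with the boundary and with the antipodal map, and it fixes points; so the tower may be
  subdivided until every simplex lies in a member of the given cover.\<close>

lemma small_antipodal_tower_exists:
  assumes "\<And>U. U \<in> \<C> \<Longrightarrow> openin (nsphere n) U" "topspace (nsphere n) \<subseteq> \<Union>\<C>"
  obtains c where "antipodal_tower n n c"
    "\<And>i \<sigma>. \<lbrakk>i \<le> n; \<sigma> \<in> Poly_Mapping.keys (c i)\<rbrakk> \<Longrightarrow> \<exists>V\<in>\<C>. \<sigma> \<in> standard_simplex i \<rightarrow> V"
proof -
  obtain c where c: "antipodal_tower n n c"
    using antipodal_tower_exists by blast
  have "\<exists>N. \<forall>M \<sigma>. N \<le> M \<and> \<sigma> \<in> Poly_Mapping.keys ((singular_subdivision i ^^ M) (c i))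
      \<longrightarrow> (\<exists>V\<in>\<C>. \<sigma> \<in> standard_simplex i \<rightarrow> V)" if "i \<le> n" for i
  proof -
    have "singular_chain i (nsphere n) (c i)"
      using c that by (simp add: antipodal_tower_def)
    from sufficient_iterated_singular_subdivision_exists[OF assms this]
    show ?thesis by metis
  qed
  then obtain N where N: "\<And>i M \<sigma>. \<lbrakk>i \<le> n; N i \<le> M; \<sigma> \<in> Poly_Mapping.keys ((singular_subdivision i ^^ M) (c i))\<rbrakk>
      \<Longrightarrow> \<exists>V\<in>\<C>. \<sigma> \<in> standard_simplex i \<rightarrow> V"
    by metis
  show thesis
  proof (rule that[OF antipodal_tower_subdivision[OF c, of "Max (N ` {..n})"]])
    fix i \<sigma> assume "i \<le> n" "\<sigma> \<in> Poly_Mapping.keys ((singular_subdivision i ^^ Max (N ` {..n})) (c i))"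
    then show "\<exists>V\<in>\<C>. \<sigma> \<in> standard_simplex i \<rightarrow> V"
      by (intro N[of i]) auto
  qed
qed

text \<open>Ky Fan's theorem in a weak form, for labellings of the points of the sphere instead of the vertices of a
  triangulation: the \<open>n\<close> labels \<open>0, \<dots>, n - 1\<close> with signs do not suffice for an odd labelling such that every
  member of some open cover is free of complementary pairs.\<close>

lemma ky_fan_nsphere:
  assumes cover: "\<And>U. U \<in> \<C> \<Longrightarrow> openin (nsphere n) U" "topspace (nsphere n) \<subseteq> \<Union>\<C>"
    and odd: "\<And>x. x \<in> topspace (nsphere n) \<Longrightarrow> t (antipode x) = t x"
      "\<And>x. x \<in> topspace (nsphere n) \<Longrightarrow> s (antipode x) \<longleftrightarrow> \<not> s x"
    and no_compl: "\<And>U x y. \<lbrakk>U \<in> \<C>; x \<in> U; y \<in> U; t x = t y\<rbrakk> \<Longrightarrow> s x = s y"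
  shows "\<exists>x\<in>topspace (nsphere n). t x \<ge> n"
proof (rule ccontr)
  assume "\<not> ?thesis"
  then have less: "t x < n" if "x \<in> topspace (nsphere n)" for x
    using that by auto
  obtain c where c: "antipodal_tower n n c"
    and small: "\<And>i \<sigma>. \<lbrakk>i \<le> n; \<sigma> \<in> Poly_Mapping.keys (c i)\<rbrakk> \<Longrightarrow> \<exists>V\<in>\<C>. \<sigma> \<in> standard_simplex i \<rightarrow> V"
    using small_antipodal_tower_exists[OF cover] by blast
  have keys: "Poly_Mapping.keys (c i) \<subseteq>
      {\<sigma>. no_complementary_edge t s i \<sigma> \<and> \<sigma> \<in> standard_simplex i \<rightarrow> topspace (nsphere n)}" if "i \<le> n" for i
  proof clarify
    fix \<sigma> assume "\<sigma> \<in> Poly_Mapping.keys (c i)"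
    then obtain V where V: "V \<in> \<C>" "\<sigma> \<in> standard_simplex i \<rightarrow> V"
      using small \<open>i \<le> n\<close> by blast
    have "no_complementary_edge t s i \<sigma>"
      unfolding no_complementary_edge_def
    proof (intro allI impI)
      fix j k assume "j \<le> i" "k \<le> i"
      then have "simplicial_vertex j \<sigma> \<in> V" "simplicial_vertex k \<sigma> \<in> V"
        using V(2) by (auto simp: simplicial_vertex_def Pi_iff)
      then show "t (simplicial_vertex j \<sigma>) = t (simplicial_vertex k \<sigma>) \<Longrightarrow>
          s (simplicial_vertex j \<sigma>) = s (simplicial_vertex k \<sigma>)"
        using no_compl V(1) by blast
    qed
    then show "no_complementary_edge t s i \<sigma> \<and> \<sigma> \<in> standard_simplex i \<rightarrow> topspace (nsphere n)"
      using V cover(1)[OF V(1)] openin_subset by fastforce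
  qed
  \<comment> \<open>the parity of \<open>a i\<close> is the invariant that passes from each stage of the tower to the next\<close>
  define a where "a = (\<lambda>i. fan_count t s True i (c i) + fan_count t s False i (c i))"
  have step: "even (a (Suc i) + a i)" if "i < n" for i
  proof -
    have "fan_count t s True i (chain_boundary (Suc i) (c (Suc i)))
        = fan_count t s True i (c i) + (-1) ^ Suc i * fan_count t s False i (c i)"
      using c that fan_count_antipode[of "c i" t s i "topspace (nsphere n)" antipode True, OF keys odd]
      by (simp add: antipodal_tower_def fan_count_add fan_count_cmul del: power_Suc)
    moreover have "even (fan_count t s True i (chain_boundary (Suc i) (c (Suc i))) + a (Suc i))"
      using even_fan_count_boundary[of "c (Suc i)" t s i True] keys[of "Suc i"] that
      by (auto simp: a_def add.assoc)
    ultimately show ?thesis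
      by (simp add: a_def del: power_Suc)
  qed
  have "odd (a i)" if "i \<le> n" for i
    using that
  proof (induction i)
    case 0
    obtain \<sigma> where "c 0 = frag_of \<sigma>" using c by (auto simp: antipodal_tower_def)
    then show ?case by (simp add: a_def fan_simplex_def fan_def)
  next
    case (Suc i)
    then show ?case using step[of i] by auto
  qed
  moreover have "a n = 0"
  proof -
    have "fan_count t s b n (c n) = 0" for b
      using fan_count_eq_0[of "c n" n "topspace (nsphere n)" t] keys[of n] less by blast
    then show ?thesis by (simp add: a_def)
  qed
  ultimately show False by (metis even_zero order_refl)
qed

text \<open>After scaling a zero-free \<open>f\<close> to absolute coordinate sum \<open>1\<close>, every point has a coordinate of absolute
  value at least \<open>1/n\<close>. The least such coordinate and its sign form an odd labelling. Complementary labels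
  differ by at least \<open>2/n\<close> in one coordinate, so they cannot occur together where every coordinate stays
  within \<open>1/n\<close> of a common value.\<close>

lemma borsuk_ulam:
  fixes f :: "nat \<Rightarrow> (nat \<Rightarrow> real) \<Rightarrow> real"
  assumes cont: "\<And>j. j < n \<Longrightarrow> continuous_map (nsphere n) euclideanreal (f j)"
    and odd: "\<And>j x. \<lbrakk>j < n; x \<in> topspace (nsphere n)\<rbrakk> \<Longrightarrow> f j (antipode x) = - f j x"
  shows "\<exists>x\<in>topspace (nsphere n). \<forall>j<n. f j x = 0"
proof (rule ccontr)
  assume neg: "\<not> ?thesis"
  let ?S = "topspace (nsphere n)"
  define g where "g = (\<lambda>x. \<Sum>j<n. \<bar>f j x\<bar>)"
  have pos: "g x > 0" if x: "x \<in> ?S" for x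
  proof -
    obtain j where "j < n" "f j x \<noteq> 0" using neg x by blast
    then have "0 < \<bar>f j x\<bar>" "\<bar>f j x\<bar> \<le> g x"
      unfolding g_def by (auto intro!: member_le_sum[of j "{..<n}" "\<lambda>j. \<bar>f j x\<bar>"])
    then show ?thesis by linarith
  qed
  define h where "h = (\<lambda>j x. f j x / g x)"
  have "g x \<noteq> 0" if "x \<in> ?S" for x using pos[OF that] by simp
  then have h_cont: "continuous_map (nsphere n) euclideanreal (h j)" if "j < n" for j
    unfolding h_def g_def using cont that
    by (intro continuous_map_real_divide continuous_map_sum continuous_map_real_abs) (auto simp: g_def)
  have g_even: "g (antipode x) = g x" if "x \<in> ?S" for x
    using odd that by (simp add: g_def)
  have h_odd: "h j (antipode x) = - h j x" if "j < n" "x \<in> ?S" for j x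
    using odd that g_even by (simp add: h_def)
  define P where "P = (\<lambda>x j. j < n \<and> 1 / n \<le> \<bar>h j x\<bar>)"
  have P: "\<exists>j. P x j" if x: "x \<in> ?S" for x
  proof (rule ccontr)
    assume "\<not> ?thesis"
    then have less: "\<bar>h j x\<bar> < 1 / n" if "j < n" for j
      using that by (auto simp: P_def not_le)
    have "n \<noteq> 0" using pos[OF x] by (intro notI) (simp add: g_def)
    have "1 = (\<Sum>j<n. \<bar>h j x\<bar>)"
      using pos[OF x] by (simp add: h_def g_def flip: sum_divide_distrib)
    also have "\<dots> < (\<Sum>j<n. 1 / n)"
      using less \<open>n \<noteq> 0\<close> by (intro sum_strict_mono) auto
    finally show False using \<open>n \<noteq> 0\<close> by simp
  qed
  define t where "t = (\<lambda>x. LEAST j. P x j)"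
  define s where "s = (\<lambda>x. 0 < h (t x) x)"
  have t: "t x < n" "1 / n \<le> \<bar>h (t x) x\<bar>" if "x \<in> ?S" for x
    using LeastI_ex[OF P[OF that]] unfolding t_def P_def by auto
  define U where "U = (\<lambda>y. {x \<in> ?S. \<forall>j\<in>{..<n}. h j x \<in> ball (h j y) (1 / n)})"
  have "\<exists>x\<in>?S. t x \<ge> n"
  proof (rule ky_fan_nsphere[where \<C> = "U ` ?S" and s = s])
    fix V assume "V \<in> U ` ?S"
    then obtain y where y: "V = U y" by auto
    have "openin (nsphere n) {x \<in> ?S. h j x \<in> ball (h j y) (1 / n)}" if "j < n" for j
      by (rule openin_continuous_map_preimage[OF h_cont[OF that]]) auto
    then have "openin (nsphere n) (?S \<inter> (\<Inter>j\<in>{..<n}. {x \<in> ?S. h j x \<in> ball (h j y) (1 / n)}))"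
      by (intro openin_Int_Inter) auto
    also have "?S \<inter> (\<Inter>j\<in>{..<n}. {x \<in> ?S. h j x \<in> ball (h j y) (1 / n)}) = V"
      by (auto simp: y U_def)
    finally show "openin (nsphere n) V" .
  next
    have "y \<in> U y" if "y \<in> ?S" for y
      using that by (auto simp: U_def)
    then show "?S \<subseteq> \<Union> (U ` ?S)" by blast
  next
    fix x assume x: "x \<in> ?S"
    have "P (antipode x) = P x"
      using x by (auto simp: P_def h_odd)
    then show tx: "t (antipode x) = t x" by (simp add: t_def)
    have "0 < 1 / real n" using t(1)[OF x] by simp
    then have "h (t x) x \<noteq> 0" using t(2)[OF x] by auto
    then show "s (antipode x) \<longleftrightarrow> \<not> s x"
      using x t(1)[OF x] by (auto simp: s_def tx h_odd)
  next
    fix V x y assume "V \<in> U ` ?S" "x \<in> V" "y \<in> V" and eq: "t x = t y"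
    then obtain z where z: "x \<in> U z" "y \<in> U z" by auto
    then have S: "x \<in> ?S" "y \<in> ?S" by (auto simp: U_def)
    have "\<bar>h (t x) z - h (t x) x\<bar> < 1 / n" "\<bar>h (t x) z - h (t x) y\<bar> < 1 / n"
      using z t(1)[OF S(1)] by (auto simp: U_def dist_real_def)
    moreover have "1 / n \<le> \<bar>h (t x) x\<bar>" "1 / n \<le> \<bar>h (t x) y\<bar>"
      using t(2)[OF S(1)] t(2)[OF S(2)] eq by auto
    ultimately show "s x = s y"
      unfolding s_def eq[symmetric] by linarith
  qed
  then show False using t(1) by (meson not_le)
qed

section \<open>The ham sandwich theorem\<close>

text \<open>The pair \<open>(a, b)\<close> stands for the affine function \<open>x \<mapsto> a \<bullet> x - b\<close>. Its \<open>d\<close> coordinates of \<open>a\<close> and the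
  number \<open>b\<close> are read off a point of the \<open>d\<close>-sphere.\<close>

lemma sphere_to_affine_parameters:
  obtains \<phi> :: "(nat \<Rightarrow> real) \<Rightarrow> 'a::euclidean_space \<times> real" where
    "continuous_map (nsphere DIM('a)) (top_of_set (- {0})) \<phi>"
    "\<And>x. \<phi> (antipode x) = - \<phi> x"
proof -
  let ?d = "DIM('a)"
  obtain e :: "nat \<Rightarrow> 'a" where e: "bij_betw e {..<?d} Basis"
    using ex_bij_betw_nat_finite[OF finite_Basis] unfolding lessThan_atLeast0 by blast
  define \<phi> where "\<phi> = (\<lambda>x :: nat \<Rightarrow> real. (\<Sum>i<?d. x i *\<^sub>R e i, x ?d))"
  have inner: "fst (\<phi> x) \<bullet> e i = x i" if "i < ?d" for x i
  proof -
    have "fst (\<phi> x) \<bullet> e i = (\<Sum>j<?d. x j * (e j \<bullet> e i))"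
      by (simp add: \<phi>_def inner_sum_left)
    also have "\<dots> = (\<Sum>j<?d. if j = i then x j else 0)"
    proof (intro sum.cong refl)
      fix j assume "j \<in> {..<?d}"
      then have "e j \<in> Basis" "e i \<in> Basis" "e j = e i \<longleftrightarrow> j = i"
        using e that by (auto simp: bij_betw_def inj_on_def)
      then show "x j * (e j \<bullet> e i) = (if j = i then x j else 0)"
        by (simp add: inner_Basis)
    qed
    also have "\<dots> = x i" using that by simp
    finally show ?thesis .
  qed
  show thesis
  proof (rule that[of \<phi>])
    have scale: "continuous_map (nsphere ?d) euclidean (\<lambda>x. x i *\<^sub>R e i)" for i
      using continuous_map_compose[OF continuous_map_nsphere_projection[of ?d i], of euclidean "\<lambda>r. r *\<^sub>R e i"]
      by (simp add: o_def continuous_intros)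
    have "continuous_map (nsphere ?d) (prod_topology euclidean euclideanreal) \<phi>"
      unfolding \<phi>_def
      by (intro continuous_map_pairedI continuous_map_sum scale continuous_map_nsphere_projection) simp
    then have "continuous_map (nsphere ?d) euclidean \<phi>"
      by simp
    moreover have "\<phi> x \<noteq> 0" if x: "x \<in> topspace (nsphere ?d)" for x
    proof
      assume "\<phi> x = 0"
      then have "x i = 0" if "i \<le> ?d" for i
        using inner[of i x] that by (cases "i = ?d") (auto simp: \<phi>_def zero_prod_def)
      then have "(\<Sum>i\<le>?d. (x i)\<^sup>2) = 0" by simp
      then show False using x by (simp add: nsphere)
    qed
    ultimately show "continuous_map (nsphere ?d) (top_of_set (- {0})) \<phi>"
      by (auto simp: continuous_map_in_subtopology)
    show "\<phi> (antipode x) = - \<phi> x" for x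
      by (simp add: \<phi>_def antipode_def sum_negf)
  qed
qed

text \<open>The measure of the side \<open>a \<bullet> x > b\<close> minus the measure of the side \<open>a \<bullet> x < b\<close>. The integral form
  gives oddness at once and makes continuity a matter of dominated convergence.\<close>

definition mass_imbalance :: "'a::euclidean_space measure \<Rightarrow> 'a \<times> real \<Rightarrow> real" where
  "mass_imbalance \<mu> = (\<lambda>(a, b). \<integral>x. sgn (a \<bullet> x - b) \<partial>\<mu>)"

lemma mass_imbalance_uminus: "mass_imbalance \<mu> (- p) = - mass_imbalance \<mu> p"
proof -
  have "sgn (b - a \<bullet> x) = - sgn (a \<bullet> x - b)" for a x :: 'a and b :: real
    by (simp add: sgn_if)
  then show ?thesis
    by (cases p) (simp add: mass_imbalance_def)
qed

lemma mass_measurable: "mass \<mu> \<Longrightarrow> f \<in> borel_measurable borel \<Longrightarrow> f \<in> borel_measurable \<mu>"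
  by (metis mass_def measurable_cong_sets)

text \<open>For \<open>a = 0\<close> and \<open>b \<noteq> 0\<close> the set \<open>a \<bullet> x = b\<close> is empty, so the statement extends to the nonzero
  constant functions, which are needed to complete the parameters of hyperplanes to a sphere.\<close>

lemma mass_AE_off_hyperplane:
  assumes "mass \<mu>" "(a, b) \<noteq> 0"
  shows "AE x in \<mu>. a \<bullet> x \<noteq> b"
proof (cases "a = 0")
  case True
  then show ?thesis using assms by (simp add: zero_prod_def)
next
  case False
  interpret finite_measure \<mu> using assms by (simp add: mass_def)
  have sets: "sets \<mu> = sets borel" and "measure \<mu> {x. a \<bullet> x = b} = 0"
    using assms False by (auto simp: mass_def hyperplane_def)
  then have "{x. a \<bullet> x = b} \<in> null_sets \<mu>"
    by (auto simp: null_sets_def emeasure_eq_measure closed_hyperplane)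
  then show ?thesis
    by (rule AE_I') auto
qed

text \<open>The integrand is bounded by \<open>1\<close>, and it converges at every point off the limiting hyperplane because
  \<open>sgn\<close> is continuous away from \<open>0\<close>.\<close>

lemma continuous_on_mass_imbalance:
  assumes "mass \<mu>"
  shows "continuous_on (- {0}) (mass_imbalance \<mu>)"
  unfolding continuous_on_sequentially
proof (intro allI ballI impI, elim conjE)
  fix u :: "nat \<Rightarrow> 'a \<times> real" and p assume p: "p \<in> - {0}" and u: "u \<longlonglongrightarrow> p"
  interpret finite_measure \<mu> using assms by (simp add: mass_def)
  have "(\<lambda>n. \<integral>x. sgn (fst (u n) \<bullet> x - snd (u n)) \<partial>\<mu>) \<longlonglongrightarrow> (\<integral>x. sgn (fst p \<bullet> x - snd p) \<partial>\<mu>)"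
  proof (rule integral_dominated_convergence[where w = "\<lambda>_. 1"])
    have "AE x in \<mu>. fst p \<bullet> x \<noteq> snd p"
      using p by (intro mass_AE_off_hyperplane[OF assms]) auto
    then show "AE x in \<mu>. (\<lambda>n. sgn (fst (u n) \<bullet> x - snd (u n))) \<longlonglongrightarrow> sgn (fst p \<bullet> x - snd p)"
    proof eventually_elim
      case (elim x)
      then show ?case using u by (intro tendsto_intros) auto
    qed
    show "AE x in \<mu>. norm (sgn (fst (u n) \<bullet> x - snd (u n))) \<le> 1" for n
      by (simp add: sgn_if)
  qed (auto intro!: mass_measurable[OF assms])
  then show "(mass_imbalance \<mu> \<circ> u) \<longlonglongrightarrow> mass_imbalance \<mu> p"
    by (simp add: mass_imbalance_def case_prod_unfold o_def)
qed

text \<open>The two sides carry the labels \<open>0\<close> and \<open>1\<close> used for equipartitions. Every other label also denotes the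
  second side, so that statements about both sides hold for all \<open>c\<close>.\<close>

definition half_space :: "'a::euclidean_space \<Rightarrow> real \<Rightarrow> nat \<Rightarrow> 'a set" where
  "half_space a b c = (if c = 0 then {x. a \<bullet> x \<ge> b} else {x. a \<bullet> x \<le> b})"

lemma half_space_borel [measurable]: "half_space a b c \<in> sets borel"
  by (simp add: half_space_def closed_halfspace_le closed_halfspace_ge)

text \<open>Off the hyperplane, which is a null set, the sign is the difference of the indicators of the two closed
  half-spaces, and their sum is \<open>1\<close>.\<close>

lemma half_space_measure_if_balanced:
  assumes \<mu>: "mass \<mu>" and "a \<noteq> 0" and zero: "mass_imbalance \<mu> (a, b) = 0"
  shows "measure \<mu> (half_space a b c) = measure \<mu> UNIV / 2"
proof -
  interpret finite_measure \<mu> using assms by (simp add: mass_def)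
  have sets [simp]: "sets \<mu> = sets borel" using \<mu> by (simp add: mass_def)
  then have space [simp]: "space \<mu> = UNIV" using sets_eq_imp_space_eq by fastforce
  let ?P = "half_space a b 0" and ?N = "half_space a b 1"
  have AE: "AE x in \<mu>. a \<bullet> x \<noteq> b"
    using \<mu> \<open>a \<noteq> 0\<close> by (intro mass_AE_off_hyperplane) (auto simp: zero_prod_def)
  have [simp]: "half_space a b c' \<in> sets \<mu>" for c' by simp
  have "0 = (\<integral>x. sgn (a \<bullet> x - b) \<partial>\<mu>)"
    using zero by (simp add: mass_imbalance_def)
  also have "\<dots> = (\<integral>x. indicator ?P x - indicator ?N x \<partial>\<mu>)"
    by (intro integral_cong_AE, (auto intro!: mass_measurable[OF \<mu>])[2])
       (use AE in eventually_elim; auto simp: half_space_def indicator_def)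
  also have "\<dots> = measure \<mu> ?P - measure \<mu> ?N"
    by (subst Bochner_Integration.integral_diff) (auto simp: less_top[symmetric])
  finally have diff: "measure \<mu> ?P = measure \<mu> ?N" by simp
  have "measure \<mu> UNIV = (\<integral>x. 1 \<partial>\<mu>)" by simp
  also have "\<dots> = (\<integral>x. indicator ?P x + indicator ?N x \<partial>\<mu>)"
    by (intro integral_cong_AE, (auto intro!: mass_measurable[OF \<mu>])[2])
       (use AE in eventually_elim; auto simp: half_space_def indicator_def)
  also have "\<dots> = measure \<mu> ?P + measure \<mu> ?N"
    by (subst Bochner_Integration.integral_add) (auto simp: less_top[symmetric])
  finally have "measure \<mu> ?P = measure \<mu> UNIV / 2" "measure \<mu> ?N = measure \<mu> UNIV / 2"
    using diff by auto
  then show ?thesis by (cases "c = 0") (simp_all add: half_space_def)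
qed

text \<open>A zero of the imbalances on the sphere of affine functions gives the hyperplane. If it has \<open>a = 0\<close>, then
  one side is the whole space and the other is empty, so balance forces every mass to be zero and any
  hyperplane will do.\<close>

lemma ham_sandwich:
  fixes \<mu> :: "'i \<Rightarrow> 'a::euclidean_space measure"
  assumes "finite I" "card I \<le> DIM('a)" and mass: "\<And>i. i \<in> I \<Longrightarrow> mass (\<mu> i)"
  shows "\<exists>a b. a \<noteq> 0 \<and> (\<forall>i\<in>I. \<forall>c. measure (\<mu> i) (half_space a b c) = measure (\<mu> i) UNIV / 2)"
proof -
  obtain \<phi> :: "(nat \<Rightarrow> real) \<Rightarrow> 'a \<times> real" where
    \<phi>: "continuous_map (nsphere DIM('a)) (top_of_set (- {0})) \<phi>"
    "\<And>x. \<phi> (antipode x) = - \<phi> x"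
    using sphere_to_affine_parameters by blast
  obtain h where h: "bij_betw h {..<card I} I"
    using ex_bij_betw_nat_finite[OF assms(1)] unfolding lessThan_atLeast0 by blast
  \<comment> \<open>with fewer masses than dimensions, the remaining components are padded with zero\<close>
  define f where "f = (\<lambda>j x. if j < card I then mass_imbalance (\<mu> (h j)) (\<phi> x) else 0)"
  have hI: "mass (\<mu> (h j))" if "j < card I" for j
    using that h mass by (auto simp: bij_betw_def)
  have "\<exists>x\<in>topspace (nsphere DIM('a)). \<forall>j<DIM('a). f j x = 0"
  proof (rule borsuk_ulam)
    fix j
    show "continuous_map (nsphere DIM('a)) euclideanreal (f j)"
    proof (cases "j < card I")
      case True
      have "continuous_map (top_of_set (- {0})) euclideanreal (mass_imbalance (\<mu> (h j)))"
        using continuous_on_mass_imbalance[OF hI[OF True]] by simp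
      from continuous_map_compose[OF \<phi>(1) this] True show ?thesis
        by (simp add: f_def o_def)
    qed (simp add: f_def)
    show "f j (antipode x) = - f j x" for x
      by (simp add: f_def \<phi>(2) mass_imbalance_uminus)
  qed
  then obtain x where x: "x \<in> topspace (nsphere DIM('a))" "\<And>j. j < DIM('a) \<Longrightarrow> f j x = 0"
    by blast
  obtain a b where ab: "\<phi> x = (a, b)" by fastforce
  have ne: "(a, b) \<noteq> 0"
    using continuous_map_image_subset_topspace[OF \<phi>(1)] x(1) by (auto simp flip: ab)
  have zero: "mass_imbalance (\<mu> i) (a, b) = 0" if "i \<in> I" for i
  proof -
    have "i \<in> h ` {..<card I}" using h that by (simp add: bij_betw_def)
    then obtain j where "j < card I" "i = h j" by blast
    then show ?thesis using x(2)[of j] assms(2) by (simp add: f_def ab)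
  qed
  show ?thesis
  proof (cases "a = 0")
    case False
    then show ?thesis using half_space_measure_if_balanced mass zero by blast
  next
    case True
    then have "b \<noteq> 0" using ne by (simp add: zero_prod_def)
    have null: "measure (\<mu> i) A = 0" if "i \<in> I" for i A
    proof -
      interpret finite_measure "\<mu> i" using mass[OF that] by (simp add: mass_def)
      have "measure (\<mu> i) (space (\<mu> i)) = 0"
        using zero[OF that] \<open>b \<noteq> 0\<close> by (simp add: mass_imbalance_def True sgn_zero_iff)
      then show ?thesis by (metis bounded_measure measure_le_0_iff)
    qed
    show ?thesis
      by (rule exI[of _ "SOME b. b \<in> Basis"], rule exI[of _ 0])
         (use null nonzero_Basis[OF SOME_Basis] in simp)
  qed
qed

section \<open>Successive bisection\<close>

text \<open>The piece of a mass inside \<open>A\<close> is again a mass on the whole space, so the ham sandwich theorem applies to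
  pieces.\<close>

lemma mass_density_indicator:
  assumes \<mu>: "mass \<mu>" and A: "A \<in> sets borel"
  shows "mass (density \<mu> (indicator A))"
    and "B \<in> sets borel \<Longrightarrow> measure (density \<mu> (indicator A)) B = measure \<mu> (A \<inter> B)"
proof -
  interpret finite_measure \<mu> using \<mu> by (simp add: mass_def)
  have sets [simp]: "sets \<mu> = sets borel" using \<mu> by (simp add: mass_def)
  have em: "emeasure (density \<mu> (indicator A)) B = emeasure \<mu> (A \<inter> B)" if "B \<in> sets borel" for B
  proof -
    have "A \<in> sets \<mu>" "B \<in> sets \<mu>" using that A by simp_all
    then have "emeasure (density \<mu> (indicator A)) B = (\<integral>\<^sup>+x. indicator A x * indicator B x \<partial>\<mu>)"
      by (subst emeasure_density) (auto intro!: borel_measurable_indicator simp del: sets)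
    also have "\<dots> = (\<integral>\<^sup>+x. indicator (A \<inter> B) x \<partial>\<mu>)"
      by (simp add: indicator_inter_arith)
    finally show ?thesis using that A by simp
  qed
  then show m: "measure (density \<mu> (indicator A)) B = measure \<mu> (A \<inter> B)" if "B \<in> sets borel" for B
    using that by (simp add: measure_def)
  show "mass (density \<mu> (indicator A))"
    unfolding mass_def
  proof (intro conjI allI impI)
    have "space \<mu> = UNIV" using sets sets_eq_imp_space_eq by fastforce
    then show "finite_measure (density \<mu> (indicator A))"
      by (intro finite_measureI) (simp add: em emeasure_eq_measure)
    fix H :: "'a set" assume H: "hyperplane H"
    then have "H \<in> sets borel" by (auto simp: hyperplane_def closed_hyperplane)
    moreover have "measure \<mu> H = 0" using H \<mu> by (simp add: mass_def)
    ultimately show "measure (density \<mu> (indicator A)) H = 0"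
      using m[of H] finite_measure_mono[of "A \<inter> H" H] by (simp add: measure_le_0_iff)
  qed simp
qed

text \<open>Downward induction on \<open>m\<close>. A cell cut out by the later hyperplanes is given by a choice \<open>g\<close> of sides, and
  the masses to be bisected by the new hyperplane are the pieces of the first \<open>2^(q+m-1)\<close> masses inside the
  cells. The later hyperplanes already equipartition these masses, since the condition at \<open>m + 1\<close> concerns
  the first \<open>2^(q+m)\<close> masses; hence the new pieces have equal measure too.\<close>

lemma bisect_successively:
  fixes q k :: nat and \<mu> :: "nat \<Rightarrow> 'a::euclidean_space measure"
  assumes "DIM('a) = 2 ^ (q + k - 1)" and "1 \<le> m" "m \<le> Suc k"
    and mass: "\<And>j. j \<in> {1..2 ^ (q + k - 1)} \<Longrightarrow> mass (\<mu> j)"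
  shows "\<exists>a b. \<forall>i\<in>{m..k}. a i \<noteq> 0 \<and> (\<forall>j\<in>{1..2 ^ (q + i - 1)}. \<forall>g\<in>{i..k} \<rightarrow> {0, 1}.
      measure (\<mu> j) (\<Inter>l\<in>{i..k}. half_space (a l) (b l) (g l)) = measure (\<mu> j) UNIV / 2 ^ card {i..k})"
    (is "\<exists>a b. \<forall>i\<in>{m..k}. ?Q a b i")
  using assms(3)
proof (induction m rule: inc_induct)
  case base
  then show ?case by simp
next
  case (step m)
  then have m: "1 \<le> m" "m \<le> k" using assms(2) by auto
  obtain a b where ab: "\<And>i. i \<in> {Suc m..k} \<Longrightarrow> ?Q a b i"
    using step.IH by blast
  define cell where "cell = (\<lambda>g. \<Inter>l\<in>{Suc m..k}. half_space (a l) (b l) (g l))"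
  have cell: "cell g \<in> sets borel" for g
    unfolding cell_def by (cases "{Suc m..k} = {}") (simp, auto intro!: sets.finite_INT)
  let ?J = "{1..2 ^ (q + m - 1)} :: nat set" and ?G = "{Suc m..k} \<rightarrow>\<^sub>E {0, 1 :: nat}"
  define \<nu> where "\<nu> = (\<lambda>(j, g). density (\<mu> j) (indicator (cell g)))"
  have J: "mass (\<mu> j)" if "j \<in> ?J" for j
  proof -
    have "j \<le> 2 ^ (q + m - 1)" using that by simp
    also have "\<dots> \<le> 2 ^ (q + k - 1)" using m by (intro power_increasing) auto
    finally show ?thesis using that by (intro mass) simp
  qed
  have "card (?J \<times> ?G) = 2 ^ (q + m - 1) * 2 ^ (k - m)"
    by (simp add: card_cartesian_product card_PiE flip: numeral_2_eq_2)
  also have "\<dots> = 2 ^ (q + k - 1)"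
    using m by (simp flip: power_add)
  finally have card: "card (?J \<times> ?G) \<le> DIM('a)" using assms(1) by simp
  have fin: "finite (?J \<times> ?G)" by (auto intro!: finite_PiE)
  have \<nu>: "mass (\<nu> p)" if "p \<in> ?J \<times> ?G" for p
    using that mass_density_indicator(1)[OF J cell] by (auto simp: \<nu>_def)
  obtain a' b' where ne: "a' \<noteq> 0" and bisect_all:
    "\<forall>p\<in>?J \<times> ?G. \<forall>c. measure (\<nu> p) (half_space a' b' c) = measure (\<nu> p) UNIV / 2"
    using ham_sandwich[where \<mu> = \<nu>, OF fin card \<nu>] by metis
  have bisect: "measure (\<nu> (j, g)) (half_space a' b' c) = measure (\<nu> (j, g)) UNIV / 2"
    if "j \<in> ?J" "g \<in> ?G" for j g c
    using bspec[OF bisect_all SigmaI[OF that]] by (rule spec)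
  let ?a = "a(m := a')" and ?b = "b(m := b')"
  have "?Q ?a ?b i" if i: "i \<in> {m..k}" for i
  proof (cases "i = m")
    case False
    then have "{i..k} \<inter> {m} = {}" using i by auto
    then have "(\<Inter>l\<in>{i..k}. half_space (?a l) (?b l) (g l)) = (\<Inter>l\<in>{i..k}. half_space (a l) (b l) (g l))" for g
      by (intro INF_cong) auto
    then show ?thesis using ab[of i] i False by auto
  next
    case True
    have "measure (\<mu> j) (\<Inter>l\<in>{m..k}. half_space (?a l) (?b l) (g l)) = measure (\<mu> j) UNIV / 2 ^ card {m..k}"
      if j: "j \<in> ?J" and g: "g \<in> {m..k} \<rightarrow> {0, 1}" for j g
    proof -
      \<comment> \<open>restriction makes the choices of sides a finite family\<close>
      let ?g = "restrict g {Suc m..k}"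
      have g_later: "g \<in> {Suc m..k} \<rightarrow> {0, 1}" using g by (auto simp: Pi_iff)
      then have g': "?g \<in> ?G" by simp
      have cell_total: "measure (\<mu> j) (cell ?g) = measure (\<mu> j) UNIV / 2 ^ (k - m)"
      proof (cases "m = k")
        case True
        then show ?thesis by (simp add: cell_def)
      next
        case False
        have "j \<le> 2 ^ (q + m - 1)" using j by simp
        also have "\<dots> \<le> 2 ^ (q + Suc m - 1)" by (intro power_increasing) auto
        finally have "j \<in> {1..2 ^ (q + Suc m - 1)}" using j by simp
        moreover have "?g \<in> {Suc m..k} \<rightarrow> {0, 1}" using g_later by (simp add: Pi_iff)
        moreover have "?Q a b (Suc m)" using ab m False by simp
        ultimately have "measure (\<mu> j) (cell ?g) = measure (\<mu> j) UNIV / 2 ^ card {Suc m..k}"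
          unfolding cell_def by blast
        then show ?thesis by simp
      qed
      have "{m..k} = insert m {Suc m..k}" using m by auto
      then have "(\<Inter>l\<in>{m..k}. half_space (?a l) (?b l) (g l)) = cell ?g \<inter> half_space a' b' (g m)"
        by (auto simp: cell_def)
      also have "measure (\<mu> j) \<dots> = measure (\<nu> (j, ?g)) (half_space a' b' (g m))"
        using mass_density_indicator(2)[OF J[OF j] cell half_space_borel] by (simp add: \<nu>_def)
      also have "\<dots> = measure (\<nu> (j, ?g)) UNIV / 2"
        by (rule bisect[OF j g'])
      also have "measure (\<nu> (j, ?g)) UNIV = measure (\<mu> j) (cell ?g)"
        using mass_density_indicator(2)[OF J[OF j] cell, of UNIV] by (simp add: \<nu>_def)
      finally show ?thesis
        using cell_total m by (simp add: Suc_diff_le)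
    qed
    with ne True show ?thesis by simp
  qed
  then show ?case by blast
qed

theorem corollary6p3:
  fixes q k :: nat
    and \<mu> :: "nat \<Rightarrow> (real ^ 'n) measure"
  assumes "k \<ge> 1"
    and "CARD('n) = 2 ^ (q + k - 1)"
    and "\<And>j. j \<in> {1..2 ^ (q + k - 1)} \<Longrightarrow> mass (\<mu> j)"
  shows "\<exists>H :: nat \<Rightarrow> (real ^ 'n) set.
           (\<forall>i\<in>{1..k}. hyperplane (H i)) \<and>
           (\<forall>i\<in>{1..k}. \<forall>j\<in>{1..2 ^ (q + i - 1)}. equipartition {i..k} H (\<mu> j))"
proof -
  have dim: "DIM(real ^ 'n) = 2 ^ (q + k - 1)" using assms(2) by simp
  have "1 \<le> Suc k" by simp
  from bisect_successively[of q k 1 \<mu>, OF dim order_refl this assms(3)] obtain a b where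
    ne: "\<And>i. i \<in> {1..k} \<Longrightarrow> a i \<noteq> 0" and
    cells: "\<And>i j g. \<lbrakk>i \<in> {1..k}; j \<in> {1..2 ^ (q + i - 1)}; g \<in> {i..k} \<rightarrow> {0, 1}\<rbrakk> \<Longrightarrow>
      measure (\<mu> j) (\<Inter>l\<in>{i..k}. half_space (a l) (b l) (g l)) = measure (\<mu> j) UNIV / 2 ^ card {i..k}"
    by blast
  define H where "H = (\<lambda>i. {x. a i \<bullet> x = b i})"
  have "equipartition {i..k} H (\<mu> j)" if "i \<in> {1..k}" "j \<in> {1..2 ^ (q + i - 1)}" for i j
    unfolding equipartition_def
  proof (intro exI[of _ "\<lambda>l. half_space (a l) (b l)"] conjI ballI)
    fix l assume "l \<in> {i..k}"
    then have "a l \<noteq> 0" using ne that by auto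
    then show "closed_half_spaces (H l) (half_space (a l) (b l) 0) (half_space (a l) (b l) 1)"
      unfolding closed_half_spaces_def H_def by (auto simp: half_space_def)
  qed (use cells[OF that] in simp)
  moreover have "hyperplane (H i)" if "i \<in> {1..k}" for i
    using ne[OF that] by (auto simp: hyperplane_def H_def)
  ultimately show ?thesis by blast
qed

end
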